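(* Suppose there exists an algorithm which takes as input a Diophantine equation $D(x_1,\ldots,x_p)=0$ and returns an integer $b\geqslant 2$, where $b$ is greater than the number of rational solutions of the equation if the set of rational solutions is finite. Then the question whether or not a Diophantine equation has only finitely many rational solutions is decidable with an oracle for deciding whether or not a Diophantine equation has a rational solution.
   Context: A Diophantine equation is an equation $D(x_1,\ldots,x_p)=0$ with $p\geqslant 1$ and $D\in\mathbb{Z}[x_1,\ldots,x_p]$; the list of variables $x_1,\ldots,x_p$ is part of the data, and a rational solution is a tuple in $\mathbb{Q}^p$. "Decidable with an oracle for" a problem means decidable by an algorithm that may query an oracle answering that problem (Turing reducibility). *)

theory Defs
  imports Complex_Main "HOL-Library.Poly_Mapping" "HOL-Library.Nat_Bijection"
begin

section \<open>Partial recursive functions relative to an oracle\<close>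

text \<open>Kleene's schemes for the partial recursive functions on tuples of natural numbers, with
  one extra initial function \<open>Query\<close>, the characteristic function of the oracle set.\<close>

datatype prog =
    Zero
  | Succ
  | Proj nat
  | Query
  | Comp prog "prog list"
  | PrimRec prog prog
  | Mu prog

text \<open>The result \<open>None\<close> means divergence (or a wrong number of arguments). Composition is strict.
  Minimisation requires the values at all smaller arguments to be defined and nonzero.\<close>

fun run :: "nat set \<Rightarrow> prog \<Rightarrow> nat list \<Rightarrow> nat option" where
  "run A Zero xs = Some 0"
| "run A Succ xs = (case xs of [x] \<Rightarrow> Some (Suc x) | _ \<Rightarrow> None)"
| "run A (Proj i) xs = (if i < length xs then Some (xs ! i) else None)"
| "run A Query xs = (case xs of [x] \<Rightarrow> Some (if x \<in> A then 1 else 0) | _ \<Rightarrow> None)"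
| "run A (Comp f gs) xs =
     (if \<forall>g\<in>set gs. run A g xs \<noteq> None
      then run A f (map (\<lambda>g. the (run A g xs)) gs) else None)"
| "run A (PrimRec f g) xs =
     (case xs of [] \<Rightarrow> None
      | n # ys \<Rightarrow>
          rec_nat (run A f ys) (\<lambda>k r. Option.bind r (\<lambda>y. run A g (k # y # ys))) n)"
| "run A (Mu f) xs =
     (if \<exists>n. run A f (n # xs) = Some 0 \<and> (\<forall>m<n. \<exists>y. run A f (m # xs) = Some (Suc y))
      then Some (LEAST n. run A f (n # xs) = Some 0) else None)"

definition turing_reducible :: "nat set \<Rightarrow> nat set \<Rightarrow> bool" where
  "turing_reducible B A \<longleftrightarrow> (\<exists>P. \<forall>n. run A P [n] = Some (if n \<in> B then 1 else 0))"


section \<open>Diophantine equations\<close>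

text \<open>An equation is a pair \<open>(p, D)\<close>; the variables \<open>x\<^sub>1, \<dots>, x\<^sub>p\<close> have the indices
  \<open>0, \<dots>, p - 1\<close>. A monomial is its finitely supported exponent function, and \<open>D\<close> maps
  monomials to coefficients. Not all \<open>p\<close> variables need to occur in \<open>D\<close>.\<close>

type_synonym int_mpoly = "(nat \<Rightarrow>\<^sub>0 nat) \<Rightarrow>\<^sub>0 int"

definition diophantine_equations :: "(nat \<times> int_mpoly) set" where
  "diophantine_equations =
     {(p, D). p \<ge> 1 \<and> (\<forall>m\<in>Poly_Mapping.keys D. Poly_Mapping.keys m \<subseteq> {..<p})}"

definition mpoly_eval :: "int_mpoly \<Rightarrow> (nat \<Rightarrow> rat) \<Rightarrow> rat" where
  "mpoly_eval D x =
     (\<Sum>m\<in>Poly_Mapping.keys D. of_int (Poly_Mapping.lookup D m) *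
        (\<Prod>i\<in>Poly_Mapping.keys m. x i ^ Poly_Mapping.lookup m i))"

definition rational_solutions :: "nat \<times> int_mpoly \<Rightarrow> rat list set" where
  "rational_solutions =
     (\<lambda>(p, D). {xs. length xs = p \<and> mpoly_eval D ((!) xs) = 0})"


section \<open>Equations as inputs of algorithms\<close>

text \<open>A monomial is presented by its list of \<open>p\<close> exponents, and an equation by \<open>p\<close> together with
  the list of its (exponents, nonzero coefficient) pairs, ordered by their numerical codes so that
  each equation has exactly one code.\<close>

definition term_code :: "nat \<Rightarrow> int_mpoly \<Rightarrow> (nat \<Rightarrow>\<^sub>0 nat) \<Rightarrow> nat" where
  "term_code p D m =
     prod_encode (list_encode (map (Poly_Mapping.lookup m) [0..<p]),
       int_encode (Poly_Mapping.lookup D m))"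

definition equation_code :: "nat \<times> int_mpoly \<Rightarrow> nat" where
  "equation_code =
     (\<lambda>(p, D). prod_encode (p,
       list_encode (sorted_list_of_set (term_code p D ` Poly_Mapping.keys D))))"

text \<open>Computability without an oracle is computability with the empty oracle. Nothing is required
  of the program on numbers that are not codes of equations.\<close>

definition computable_on_equations :: "(nat \<times> int_mpoly \<Rightarrow> nat) \<Rightarrow> bool" where
  "computable_on_equations b \<longleftrightarrow>
     (\<exists>P. \<forall>E\<in>diophantine_equations. run {} P [equation_code E] = Some (b E))"

lemma exponents_inject:
  assumes "Poly_Mapping.keys m \<subseteq> {..<p}" "Poly_Mapping.keys n \<subseteq> {..<p}"
    and "map (Poly_Mapping.lookup m) [0..<p] = map (Poly_Mapping.lookup n) [0..<p]"
  shows "m = n"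
proof (rule poly_mapping_eqI)
  fix i
  show "Poly_Mapping.lookup m i = Poly_Mapping.lookup n i"
  proof (cases "i < p")
    case True
    with assms(3) show ?thesis by simp
  next
    case False
    with assms(1,2) have "i \<notin> Poly_Mapping.keys m" "i \<notin> Poly_Mapping.keys n" by auto
    then show ?thesis by (simp add: in_keys_iff)
  qed
qed

lemma inj_on_equation_code: "inj_on equation_code diophantine_equations"
proof (rule inj_onI)
  fix E F
  assume E: "E \<in> diophantine_equations" and F: "F \<in> diophantine_equations"
    and eq: "equation_code E = equation_code F"
  obtain p D where [simp]: "E = (p, D)" by (cases E)
  obtain q G where [simp]: "F = (q, G)" by (cases F)
  from eq have q[simp]: "q = p"
    and "sorted_list_of_set (term_code p D ` Poly_Mapping.keys D) =
      sorted_list_of_set (term_code q G ` Poly_Mapping.keys G)"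
    by (auto simp: equation_code_def list_encode_eq)
  then have im: "term_code p D ` Poly_Mapping.keys D = term_code p G ` Poly_Mapping.keys G"
    by (metis finite_imageI finite_keys set_sorted_list_of_set)
  have le: "Poly_Mapping.lookup H m = Poly_Mapping.lookup K m"
    if HK: "term_code p H ` Poly_Mapping.keys H = term_code p K ` Poly_Mapping.keys K"
      and m: "m \<in> Poly_Mapping.keys H"
      and H: "\<forall>m\<in>Poly_Mapping.keys H. Poly_Mapping.keys m \<subseteq> {..<p}"
      and K: "\<forall>m\<in>Poly_Mapping.keys K. Poly_Mapping.keys m \<subseteq> {..<p}" for H K m
  proof -
    have "term_code p H m \<in> term_code p K ` Poly_Mapping.keys K"
      unfolding HK[symmetric] using m by (rule imageI)
    then obtain n where n: "term_code p H m = term_code p K n" "n \<in> Poly_Mapping.keys K"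
      by (rule imageE)
    from n(1) have e: "map (Poly_Mapping.lookup m) [0..<p] = map (Poly_Mapping.lookup n) [0..<p]"
      and l: "Poly_Mapping.lookup H m = Poly_Mapping.lookup K n"
      by (simp_all add: term_code_def list_encode_eq int_encode_eq del: map_eq_conv)
    from H m K n(2) e have "m = n" by (intro exponents_inject) auto
    with l show ?thesis by simp
  qed
  have D: "\<forall>m\<in>Poly_Mapping.keys D. Poly_Mapping.keys m \<subseteq> {..<p}"
    and G: "\<forall>m\<in>Poly_Mapping.keys G. Poly_Mapping.keys m \<subseteq> {..<p}"
    using E F by (auto simp: diophantine_equations_def)
  have "D = G"
  proof (rule poly_mapping_eqI)
    fix m
    show "Poly_Mapping.lookup D m = Poly_Mapping.lookup G m"
    proof (cases "m \<in> Poly_Mapping.keys D \<or> m \<in> Poly_Mapping.keys G")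
      case True
      then show ?thesis using le[OF im _ D G] le[OF im[symmetric] _ G D] by auto
    next
      case False
      then show ?thesis by (simp add: in_keys_iff)
    qed
  qed
  then show "E = F" by simp
qed

end

theory Submission
  imports Defs
begin

text \<open>Let an equation \<open>D(x\<^sub>1, \<dots>, x\<^sub>p) = 0\<close> be given, and let \<open>b\<close> be the bound that the assumed
  algorithm returns for it. If the equation has finitely many rational solutions, it has fewer than
  \<open>b\<close>; if it has infinitely many, it has at least \<open>b\<close>. So the solution set is finite if and only if
  there are no \<open>b\<close> distinct solutions, and the existence of \<open>b\<close> distinct solutions is the solvability
  of the single equation
  \<open>\<Sum>\<^bsub>i<b\<^esub> D(a\<^sub>i)\<^sup>2 + (z \<cdot> \<Prod>\<^bsub>i<j<b\<^esub> \<bar>a\<^sub>i - a\<^sub>j\<bar>\<^sup>2 - 1)\<^sup>2 = 0\<close>,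
  where each \<open>a\<^sub>i\<close> stands for \<open>p\<close> new variables and \<open>\<bar>\<cdot>\<bar>\<close> is the Euclidean norm. It has
  \<open>p b + 1\<close> variables. Over an ordered field a sum of squares vanishes only if each square does,
  and the last variable \<open>z\<close> is the inverse of a product that is nonzero precisely if the \<open>b\<close>
  points are pairwise distinct (\<open>solutions_several_solutions\<close>). One oracle query therefore
  decides finiteness.

  It remains to see that the code of the new equation is computable from the code of the old one,
  by a program that halts on every number. Kleene programs are lifted to functions between
  types with a bijective numbering, and the class of computable functions is shown to be closed under
  the usual list operations, so that the constructions can be written as ordinary functional
  programs. Polynomials are handled as unreduced lists of terms, on which addition and multiplication
  are trivial; only \<open>normal_form\<close> collects and sorts the terms, and it yields the code of the
  equation (\<open>equation_code_polynomial\<close>). The same function recognises codes: a number is the code of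
  an equation if and only if it denotes a positive number of variables together with a list of terms
  that is its own normal form (\<open>is_equation\<close>). On all other numbers the program for \<open>b\<close> may diverge, so these are replaced
  by a fixed code before \<open>b\<close> is evaluated.\<close>

section \<open>Computable functions between encoded types\<close>

text \<open>The numbering is required to be bijective, so that every number denotes a value of every encoded
  type. A total function on an encoded type is then given by a program that halts on all inputs.\<close>

class encodable =
  fixes enc :: "'a \<Rightarrow> nat"
  assumes bij_enc: "bij enc"

definition dec :: "nat \<Rightarrow> 'a::encodable" where
  "dec = inv enc"

lemma dec_enc [simp]: "dec (enc x) = x"
  by (simp add: dec_def bij_enc bij_is_inj)

lemma enc_dec [simp]: "enc (dec n :: 'a::encodable) = n"
  using bij_enc[where 'a = 'a] by (simp add: dec_def bij_is_surj surj_f_inv_f)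

lemma enc_eq_iff [simp]: "enc x = enc y \<longleftrightarrow> x = y"
  by (metis dec_enc)

lemma dec_eqI: "enc x = n \<Longrightarrow> dec n = x"
  by auto

instantiation nat :: encodable
begin
definition enc_nat :: "nat \<Rightarrow> nat" where [simp]: "enc_nat n = n"
instance by standard (simp add: bij_def inj_def surj_def)
end

instantiation int :: encodable
begin
definition enc_int :: "int \<Rightarrow> nat" where "enc_int = int_encode"
instance by standard (simp add: enc_int_def bij_int_encode)
end

instantiation prod :: (encodable, encodable) encodable
begin
definition enc_prod :: "'a \<times> 'b \<Rightarrow> nat" where
  "enc_prod z = prod_encode (enc (fst z), enc (snd z))"
instance
proof
  have "inj (enc :: 'a \<times> 'b \<Rightarrow> nat)"
    by (auto simp: inj_def enc_prod_def)
  moreover have "surj (enc :: 'a \<times> 'b \<Rightarrow> nat)"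
  proof (rule surjI)
    show "enc (dec (fst (prod_decode n)) :: 'a, dec (snd (prod_decode n)) :: 'b) = n" for n
      by (simp add: enc_prod_def)
  qed
  ultimately show "bij (enc :: 'a \<times> 'b \<Rightarrow> nat)" by (rule bijI)
qed
end

instantiation list :: (encodable) encodable
begin
definition enc_list :: "'a list \<Rightarrow> nat" where
  "enc_list xs = list_encode (map enc xs)"
instance
proof
  have "inj (enc :: 'a list \<Rightarrow> nat)"
    by (auto simp: inj_def enc_list_def list_encode_eq inj_map_eq_map)
  moreover have "surj (enc :: 'a list \<Rightarrow> nat)"
  proof (rule surjI)
    show "enc (map dec (list_decode n) :: 'a list) = n" for n
      by (simp add: enc_list_def comp_def)
  qed
  ultimately show "bij (enc :: 'a list \<Rightarrow> nat)" by (rule bijI)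
qed
end

lemma enc_Nil [simp]: "enc [] = 0"
  by (simp add: enc_list_def)

lemma enc_Cons: "enc (x # xs) = Suc (enc (x, xs))"
  by (simp add: enc_list_def enc_prod_def)

lemma enc_nat_list: "enc xs = list_encode xs"
  by (induction xs) (simp_all add: enc_Cons enc_prod_def)

definition computable :: "nat set \<Rightarrow> ('a::encodable \<Rightarrow> 'b::encodable) \<Rightarrow> bool" where
  "computable A f \<longleftrightarrow> (\<exists>P. \<forall>x. run A P [enc x] = Some (enc (f x)))"

definition decidable :: "nat set \<Rightarrow> ('a::encodable \<Rightarrow> bool) \<Rightarrow> bool" where
  "decidable A p \<longleftrightarrow> computable A (\<lambda>x. of_bool (p x) :: nat)"

text \<open>Every natural number is its own code, so a program for the characteristic function needs no
  translation.\<close>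

lemma turing_reducible_iff: "turing_reducible B A \<longleftrightarrow> decidable A (\<lambda>n::nat. n \<in> B)"
  by (simp add: turing_reducible_def decidable_def computable_def of_bool_def)

named_theorems comp_intros \<open>closure properties of the computable functions\<close>

lemma computable_compose:
  assumes "computable A f" "computable A g"
  shows "computable A (\<lambda>x. f (g x))"
proof -
  obtain P Q where "\<And>x. run A P [enc x] = Some (enc (f x))" "\<And>x. run A Q [enc x] = Some (enc (g x))"
    using assms unfolding computable_def by blast
  then have "\<forall>x. run A (Comp P [Q]) [enc x] = Some (enc (f (g x)))" by simp
  then show ?thesis unfolding computable_def by blast
qed

lemma decidable_compose:
  assumes "decidable A p" "computable A g"
  shows "decidable A (\<lambda>x. p (g x))"
  using computable_compose[OF assms(1)[unfolded decidable_def] assms(2)] by (simp add: decidable_def)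

lemma computable_id [comp_intros]: "computable A (\<lambda>x. x)"
  unfolding computable_def by (rule exI[of _ "Proj 0"]) simp

lemma computable_const [comp_intros]: "computable A (\<lambda>x. c)"
proof -
  have "\<exists>P. \<forall>xs. run A P xs = Some n" for n
  proof (induction n)
    case 0
    show ?case by (rule exI[of _ Zero]) simp
  next
    case (Suc n)
    then obtain P where "\<forall>xs. run A P xs = Some n" ..
    then have "\<forall>xs. run A (Comp Succ [P]) xs = Some (Suc n)" by simp
    then show ?case by blast
  qed
  then show ?thesis unfolding computable_def by blast
qed

text \<open>Moving between a value and its code leaves the underlying number alone, so it needs no
  program. This makes it possible to compute with the codes of values of any encoded type.\<close>

lemma computable_recode:
  assumes "\<And>x. enc (g x) = enc (f x)" "computable A f"
  shows "computable A g"
  using assms by (simp add: computable_def)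

lemma computable_enc [comp_intros]: "computable A f \<Longrightarrow> computable A (\<lambda>x. enc (f x))"
  by (rule computable_recode[where f = f]) simp_all

lemma computable_dec [comp_intros]: "computable A f \<Longrightarrow> computable A (\<lambda>x. dec (f x))"
  by (rule computable_recode[where f = f]) simp_all

lemma computable_Suc [comp_intros]: "computable A f \<Longrightarrow> computable A (\<lambda>x. Suc (f x))"
  by (rule computable_compose[of _ Suc]) (auto simp: computable_def intro!: exI[of _ Succ])

definition add_prog :: prog where
  "add_prog = PrimRec (Proj 0) (Comp Succ [Proj 1])"

definition pred_prog :: prog where
  "pred_prog = PrimRec Zero (Proj 0)"

definition monus_prog :: prog where
  "monus_prog = Comp (PrimRec (Proj 0) (Comp pred_prog [Proj 1])) [Proj 1, Proj 0]"

definition triangle_prog :: prog where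
  "triangle_prog = PrimRec Zero (Comp Succ [Comp add_prog [Proj 0, Proj 1]])"

definition pair_prog :: prog where
  "pair_prog = Comp add_prog [Comp triangle_prog [add_prog], Proj 0]"

lemma run_add_prog [simp]: "run A add_prog [m, n] = Some (m + n)"
proof -
  have "rec_nat (Some n) (\<lambda>k r. Option.bind r (\<lambda>y. Some (Suc y))) m = Some (m + n)"
    by (induction m) simp_all
  then show ?thesis by (simp add: add_prog_def)
qed

lemma run_pred_prog [simp]: "run A pred_prog [n] = Some (n - 1)"
proof (cases n)
  case (Suc m)
  have "\<exists>y. rec_nat (Some 0) (\<lambda>k r. Option.bind r (\<lambda>y. Some k)) m = Some y"
    by (induction m) auto
  then show ?thesis using Suc by (auto simp: pred_prog_def)
qed (simp add: pred_prog_def)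

lemma run_monus_prog [simp]: "run A monus_prog [m, n] = Some (m - n)"
proof -
  have "rec_nat (Some m) (\<lambda>k r. Option.bind r (\<lambda>y. Some (y - 1))) n = Some (m - n)"
    by (induction n) simp_all
  then show ?thesis by (simp add: monus_prog_def)
qed

lemma run_triangle_prog [simp]: "run A triangle_prog [n] = Some (triangle n)"
proof -
  have "rec_nat (Some 0) (\<lambda>k r. Option.bind r (\<lambda>y. Some (Suc (k + y)))) n = Some (triangle n)"
    by (induction n) (simp_all add: add.commute)
  then show ?thesis by (simp add: triangle_prog_def)
qed

lemma run_pair_prog [simp]: "run A pair_prog [m, n] = Some (prod_encode (m, n))"
  by (simp add: pair_prog_def prod_encode_def)

text \<open>The pairing function enumerates the pairs along the diagonals \<open>m + n = s\<close>. A pair can be recovered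
  from its code once its diagonal is known, and the diagonal of \<open>z\<close> satisfies a recursion
  that involves only its previous value: it grows by one exactly when \<open>Suc z\<close> reaches the next
  triangular number. Hence the inverse of pairing needs no search.\<close>

definition diagonal :: "nat \<Rightarrow> nat" where
  "diagonal z = fst (prod_decode z) + snd (prod_decode z)"

lemma diagonal_bounds: "triangle (diagonal z) \<le> z" "z \<le> triangle (diagonal z) + diagonal z"
proof -
  obtain m n where "prod_decode z = (m, n)" by (rule prod.exhaust)
  then have "prod_encode (m, n) = z" "diagonal z = m + n" "fst (prod_decode z) = m"
    by (metis prod_decode_inverse) (simp_all add: diagonal_def \<open>prod_decode z = (m, n)\<close>)
  then have "triangle (diagonal z) + fst (prod_decode z) = z"
    by (simp add: prod_encode_def)
  then show "triangle (diagonal z) \<le> z" "z \<le> triangle (diagonal z) + diagonal z"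
    by (auto simp: diagonal_def)
qed

lemma triangle_mono: "m \<le> n \<Longrightarrow> triangle m \<le> triangle n"
  by (induction rule: dec_induct) simp_all

lemma diagonal_unique:
  assumes "triangle s \<le> z" "z \<le> triangle s + s"
  shows "diagonal z = s"
proof -
  have "\<not> s < diagonal z"
    using triangle_mono[of "Suc s" "diagonal z"] assms diagonal_bounds[of z] by auto
  moreover have "\<not> diagonal z < s"
    using triangle_mono[of "Suc (diagonal z)" s] assms diagonal_bounds[of z] by auto
  ultimately show ?thesis by simp
qed

lemma diagonal_0: "diagonal 0 = 0"
  by (rule diagonal_unique) simp_all

lemma diagonal_Suc:
  "diagonal (Suc z) = diagonal z + (1 - (triangle (Suc (diagonal z)) - Suc z))"
proof (cases "z = triangle (diagonal z) + diagonal z")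
  case True
  then have "diagonal (Suc z) = Suc (diagonal z)"
    by (intro diagonal_unique) simp_all
  with True show ?thesis by simp
next
  case False
  then have "diagonal (Suc z) = diagonal z"
    using diagonal_bounds[of z] by (intro diagonal_unique) simp_all
  with False show ?thesis using diagonal_bounds(2)[of z] by simp
qed

definition diagonal_prog :: prog where
  "diagonal_prog = PrimRec Zero (Comp add_prog [Proj 1, Comp monus_prog [Comp Succ [Zero],
     Comp monus_prog [Comp triangle_prog [Comp Succ [Proj 1]], Comp Succ [Proj 0]]]])"

lemma run_diagonal_prog [simp]: "run A diagonal_prog [z] = Some (diagonal z)"
proof -
  have "rec_nat (Some 0) (\<lambda>k r. Option.bind r
      (\<lambda>y. Some (y + (1 - (triangle (Suc y) - Suc k))))) z = Some (diagonal z)"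
    by (induction z) (simp_all add: diagonal_0 diagonal_Suc del: triangle_Suc)
  then show ?thesis by (simp add: diagonal_prog_def del: triangle_Suc)
qed

definition fst_prog :: prog where
  "fst_prog = Comp monus_prog [Proj 0, Comp triangle_prog [diagonal_prog]]"

definition snd_prog :: prog where
  "snd_prog = Comp monus_prog [diagonal_prog, fst_prog]"

lemma run_fst_prog [simp]: "run A fst_prog [prod_encode (m, n)] = Some m"
  by (simp add: fst_prog_def diagonal_def) (simp add: prod_encode_def)

lemma run_snd_prog [simp]: "run A snd_prog [prod_encode (m, n)] = Some n"
  by (simp add: snd_prog_def diagonal_def)

lemma computable_fst [comp_intros]: "computable A f \<Longrightarrow> computable A (\<lambda>x. fst (f x))"
  by (rule computable_compose[of _ fst])
    (auto simp: computable_def enc_prod_def intro!: exI[of _ fst_prog])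

lemma computable_snd [comp_intros]: "computable A f \<Longrightarrow> computable A (\<lambda>x. snd (f x))"
  by (rule computable_compose[of _ snd])
    (auto simp: computable_def enc_prod_def intro!: exI[of _ snd_prog])

lemma computable_Pair [comp_intros]:
  assumes "computable A f" "computable A g"
  shows "computable A (\<lambda>x. (f x, g x))"
proof -
  obtain P Q where "\<And>x. run A P [enc x] = Some (enc (f x))" "\<And>x. run A Q [enc x] = Some (enc (g x))"
    using assms unfolding computable_def by blast
  then have "\<forall>x. run A (Comp pair_prog [P, Q]) [enc x] = Some (enc (f x, g x))"
    by (simp add: enc_prod_def)
  then show ?thesis unfolding computable_def by blast
qed

text \<open>Functions of several arguments are proved computable on tuples. These rules turn such a fact into
  a closure rule; in the rules for binders (\<open>rec_nat\<close>, \<open>foldr\<close>, \<open>map\<close>, and so on), the bound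
  variables become components of a tuple in the same way.\<close>

lemma computable_compose2:
  assumes "computable A (\<lambda>z. F (fst z) (snd z))" "computable A f" "computable A g"
  shows "computable A (\<lambda>x. F (f x) (g x))"
  using computable_compose[OF assms(1) computable_Pair[OF assms(2,3)]] by simp

lemma computable_compose3:
  assumes "computable A (\<lambda>z. F (fst z) (fst (snd z)) (snd (snd z)))"
    "computable A f" "computable A g" "computable A h"
  shows "computable A (\<lambda>x. F (f x) (g x) (h x))"
  using computable_compose[OF assms(1) computable_Pair[OF assms(2) computable_Pair[OF assms(3,4)]]]
  by simp

lemma decidable_compose2:
  assumes "decidable A (\<lambda>z. p (fst z) (snd z))" "computable A f" "computable A g"
  shows "decidable A (\<lambda>x. p (f x) (g x))"
  using decidable_compose[OF assms(1) computable_Pair[OF assms(2,3)]] by simp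

lemma computable_rec_nat [comp_intros]:
  assumes "computable A a" "computable A (\<lambda>z. g (fst z) (fst (snd z)) (snd (snd z)))"
    "computable A n"
  shows "computable A (\<lambda>x. rec_nat (a x) (g x) (n x))"
proof -
  obtain P Q N where P: "\<And>x. run A P [enc x] = Some (enc (a x))"
    and Q: "\<And>z. run A Q [enc z] = Some (enc (g (fst z) (fst (snd z)) (snd (snd z))))"
    and N: "\<And>x. run A N [enc x] = Some (enc (n x))"
    using assms unfolding computable_def by blast
  \<comment> \<open>The recursion scheme passes the counter, the previous value and the parameter; \<open>Q\<close> expects
    them as a single tuple with the parameter first.\<close>
  let ?G = "Comp Q [Comp pair_prog [Proj 2, Comp pair_prog [Proj 0, Proj 1]]]"
  have G: "run A ?G [k, enc r, enc x] = Some (enc (g x k r))" for k r x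
    using Q[of "(x, k, r)"] by (simp add: enc_prod_def)
  have "rec_nat (Some (enc (a x)))
      (\<lambda>k r. Option.bind r (\<lambda>y. run A ?G [k, y, enc x])) m = Some (enc (rec_nat (a x) (g x) m))" for x m
    by (induction m) (simp_all only: nat.rec Option.bind.simps G)
  then have "\<forall>x. run A (Comp (PrimRec P ?G) [N, Proj 0]) [enc x] = Some (enc (rec_nat (a x) (g x) (n x)))"
    by (simp add: P N)
  then show ?thesis unfolding computable_def by blast
qed

lemma decidable_oracle [comp_intros]: "computable A f \<Longrightarrow> decidable A (\<lambda>x. (f x :: nat) \<in> A)"
  by (rule decidable_compose[of _ "\<lambda>n. n \<in> A"])
    (auto simp: decidable_def computable_def intro!: exI[of _ Query])

lemma computable_if [comp_intros]:
  assumes "decidable A p" "computable A f" "computable A g"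
  shows "computable A (\<lambda>x. if p x then f x else g x)"
proof -
  have "computable A (\<lambda>x. rec_nat (g x) (\<lambda>_ _. f x) (of_bool (p x)))"
    by (intro comp_intros computable_compose[OF assms(2)] assms(3) assms(1)[unfolded decidable_def])
  moreover have "(\<lambda>x. rec_nat (g x) (\<lambda>_ _. f x) (of_bool (p x))) = (\<lambda>x. if p x then f x else g x)"
    by auto
  ultimately show ?thesis by simp
qed

section \<open>Arithmetic\<close>

lemma computable_add [comp_intros]:
  assumes "computable A f" "computable A g"
  shows "computable A (\<lambda>x. f x + g x :: nat)"
proof -
  have "rec_nat m (\<lambda>_ r. Suc r) n = m + n" for m n by (induction n) simp_all
  moreover have "computable A (\<lambda>x. rec_nat (f x) (\<lambda>_ r. Suc r) (g x))"
    by (intro comp_intros assms)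
  ultimately show ?thesis by simp
qed

lemma computable_mult [comp_intros]:
  assumes "computable A f" "computable A g"
  shows "computable A (\<lambda>x. f x * g x :: nat)"
proof -
  have "rec_nat 0 (\<lambda>_ r. m + r) n = m * n" for m n :: nat by (induction n) simp_all
  moreover have "computable A (\<lambda>x. rec_nat 0 (\<lambda>_ r. f x + r) (g x))"
    by (intro comp_intros assms computable_compose[OF assms(1)])
  ultimately show ?thesis by simp
qed

lemma computable_diff [comp_intros]:
  assumes "computable A f" "computable A g"
  shows "computable A (\<lambda>x. f x - g x :: nat)"
proof -
  have pred: "rec_nat 0 (\<lambda>k _. k) n = n - 1" for n by (cases n) simp_all
  have "rec_nat m (\<lambda>_ r. rec_nat 0 (\<lambda>k _. k) r) n = m - n" for m n
    by (induction n) (simp_all add: pred)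
  moreover have "computable A (\<lambda>x. rec_nat (f x) (\<lambda>_ r. rec_nat 0 (\<lambda>k _. k) r) (g x))"
    by (intro comp_intros assms)
  ultimately show ?thesis by simp
qed

lemma decidable_eq_0: 
  assumes "computable A f" 
  shows "decidable A (\<lambda>x. f x = (0::nat))"
proof -
  have "of_bool (n = (0::nat)) = 1 - n" for n by auto
  then show ?thesis
    unfolding decidable_def by (auto intro!: comp_intros assms)
qed

lemma decidable_less [comp_intros]:
  assumes "computable A f" "computable A g"
  shows "decidable A (\<lambda>x. (f x :: nat) < g x)"
proof -
  have "m < n \<longleftrightarrow> Suc m - n = 0" for m n :: nat by auto
  then show ?thesis by (simp only:) (intro decidable_eq_0 comp_intros assms)
qed

lemma decidable_eq [comp_intros]:
  assumes "computable A f" "computable A g"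
  shows "decidable A (\<lambda>x. f x = g x)"
proof -
  have "a = b \<longleftrightarrow> (enc a - enc b) + (enc b - enc a) = 0" for a b :: 'b
    unfolding enc_eq_iff[symmetric, of a b] by arith
  from this[of "f x" "g x" for x] show ?thesis by (simp only:) (intro decidable_eq_0 comp_intros assms)
qed

lemma decidable_not [comp_intros]:
  assumes "decidable A p" shows "decidable A (\<lambda>x. \<not> p x)"
proof -
  have "decidable A (\<lambda>x. of_bool (p x) = (0::nat))"
    by (intro decidable_eq_0 assms[unfolded decidable_def])
  then show ?thesis by simp
qed

lemma decidable_conj [comp_intros]:
  assumes "decidable A p" "decidable A q" shows "decidable A (\<lambda>x. p x \<and> q x)"
proof -
  have "computable A (\<lambda>x. of_bool (p x) * of_bool (q x) :: nat)"
    by (intro comp_intros assms[unfolded decidable_def])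
  then show ?thesis by (simp add: decidable_def of_bool_conj)
qed

text \<open>The numbering of the integers runs through \<open>0, -1, 1, -2, 2, \<dots>\<close>, so the integer with a given
  code is found by primitive recursion, provided it is kept as a pair of natural numbers (positive
  part and negative part). Ring operations on the integers then reduce to those on such pairs.\<close>

lemma int_decode_Suc:
  "int_decode (Suc n) = (if int_decode n \<ge> 0 then - int_decode n - 1 else - int_decode n)"
proof (cases "even n")
  case True
  then obtain m where "n = 2 * m" ..
  then show ?thesis by (simp add: int_decode_def sum_decode_def)
next
  case False
  then obtain m where "n = 2 * m + 1" ..
  then show ?thesis by (simp add: int_decode_def sum_decode_def)
qed

lemma computable_int_parts:
  assumes "computable A f"
  shows "computable A (\<lambda>x. (nat (f x), nat (- f x)))"
proof -
  let ?step = "\<lambda>r. if snd r = 0 then (0, Suc (fst r)) else (snd r, 0::nat)"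
  have "rec_nat (0, 0) (\<lambda>_. ?step) n = (nat (int_decode n), nat (- int_decode n))" for n
  proof (induction n)
    case 0
    show ?case by (simp add: int_decode_def sum_decode_def)
  next
    case (Suc n)
    then show ?case by (auto simp: int_decode_Suc nat_diff_distrib)
  qed
  from this[of "enc (f x)" for x]
  have "(nat (f x), nat (- f x)) = rec_nat (0, 0) (\<lambda>_. ?step) (enc (f x))" for x
    by (simp add: enc_int_def)
  then show ?thesis by (simp only:) (intro comp_intros assms)
qed

lemma computable_nat [comp_intros]: "computable A f \<Longrightarrow> computable A (\<lambda>x. nat (f x))"
  by (drule computable_int_parts, drule computable_fst) simp

lemma computable_nat_uminus [comp_intros]: "computable A f \<Longrightarrow> computable A (\<lambda>x. nat (- f x))"
  by (drule computable_int_parts, drule computable_snd) simp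

lemma computable_int_diff:
  assumes "computable A f" "computable A g"
  shows "computable A (\<lambda>x. int (f x) - int (g x))"
proof -
  have "int a - int b = dec (if a < b then Suc (2 * (b - a - 1)) else 2 * (a - b))" for a b
  proof (rule dec_eqI[symmetric])
    have "nat (- (int a - int b) - 1) = b - a - 1" "nat (int a - int b) = a - b" by linarith+
    then show "enc (int a - int b) = (if a < b then Suc (2 * (b - a - 1)) else 2 * (a - b))"
      by (simp add: enc_int_def int_encode_def sum_encode_def)
  qed
  then show ?thesis by (simp only:) (intro comp_intros assms)
qed

lemma computable_int_add [comp_intros]:
  assumes "computable A f" "computable A g"
  shows "computable A (\<lambda>x. f x + g x :: int)"
proof -
  have "i + j = int (nat i + nat j) - int (nat (- i) + nat (- j))" for i j :: int by simp
  then show ?thesis by (simp only:) (intro computable_int_diff comp_intros assms)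
qed

lemma computable_int_mult [comp_intros]:
  assumes "computable A f" "computable A g"
  shows "computable A (\<lambda>x. f x * g x :: int)"
proof -
  have "i * j = int (nat i * nat j + nat (- i) * nat (- j)) - int (nat i * nat (- j) + nat (- i) * nat j)"
    for i j :: int
  proof -
    have "i * j = (int (nat i) - int (nat (- i))) * (int (nat j) - int (nat (- j)))" by simp
    then show ?thesis by (simp add: algebra_simps del: int_nat_eq)
  qed
  then show ?thesis by (simp only:) (intro computable_int_diff comp_intros assms)
qed

section \<open>Lists\<close>

lemma computable_Cons [comp_intros]:
  assumes "computable A f" "computable A g"
  shows "computable A (\<lambda>x. f x # g x)"
proof -
  have "f x # g x = dec (Suc (enc (f x, g x)))" for x
    by (rule dec_eqI[symmetric]) (simp add: enc_Cons)
  then show ?thesis by (simp only:) (intro comp_intros assms)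
qed

lemma computable_case_list [comp_intros]:
  assumes "computable A l" "computable A a" "computable A (\<lambda>z. g (fst z) (fst (snd z)) (snd (snd z)))"
  shows "computable A (\<lambda>x. case l x of [] \<Rightarrow> a x | y # ys \<Rightarrow> g x y ys)"
proof -
  have "(case l x of [] \<Rightarrow> a x | y # ys \<Rightarrow> g x y ys) =
      (if l x = [] then a x else let d = dec (enc (l x) - 1) in g x (fst d) (snd d))" for x
    by (cases "l x") (simp_all add: enc_Cons)
  then show ?thesis
    by (simp only: Let_def) (intro comp_intros assms computable_compose3[OF assms(3)])
qed

text \<open>The length of a list is at most its code, hence the code itself can serve as the number of
  iterations when a list is consumed from the front.\<close>

lemma length_le_enc: "length xs \<le> enc xs"
proof (induction xs)
  case (Cons x xs)
  have "enc xs \<le> enc (x, xs)" by (simp add: enc_prod_def le_prod_encode_2)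
  with Cons show ?case by (simp add: enc_Cons)
qed simp

lemma computable_fold:
  assumes "computable A (\<lambda>z. g (fst z) (fst (snd z)) (snd (snd z)))" "computable A l" "computable A i"
  shows "computable A (\<lambda>x. fold (g x) (l x) (i x))"
proof -
  \<comment> \<open>The state is the unread rest of the list and the accumulator; an empty rest is a fixed point.\<close>
  let ?step = "\<lambda>x s. case fst s of [] \<Rightarrow> s | y # ys \<Rightarrow> (ys, g x y (snd s))"
  have step: "length xs \<le> n \<Longrightarrow> (?step x ^^ n) (xs, s) = ([], fold (g x) xs s)" for x xs s n
  proof (induction n arbitrary: xs s)
    case (Suc n)
    then show ?case by (cases xs) (simp_all add: funpow_Suc_right del: funpow.simps)
  qed simp
  have funpow: "(h ^^ n) t = rec_nat t (\<lambda>_. h) n" for h :: "'b list \<times> 'c \<Rightarrow> 'b list \<times> 'c" and n t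
    by (induction n) simp_all
  have "fold (g x) (l x) (i x) = snd (rec_nat (l x, i x) (\<lambda>_. ?step x) (enc (l x)))" for x
    by (simp only: step[OF length_le_enc] funpow[symmetric] snd_conv)
  then show ?thesis
    by (simp only:) (intro comp_intros assms computable_compose3[OF assms(1)])
qed

lemma computable_rev:
  assumes "computable A l" shows "computable A (\<lambda>x. rev (l x))"
proof -
  have "rev (l x) = fold (\<lambda>y r. y # r) (l x) []" for x by (simp add: rev_conv_fold)
  then show ?thesis by (simp only:) (intro comp_intros computable_fold assms)
qed

lemma computable_foldr [comp_intros]:
  assumes "computable A (\<lambda>z. g (fst z) (fst (snd z)) (snd (snd z)))" "computable A l" "computable A i"
  shows "computable A (\<lambda>x. foldr (g x) (l x) (i x))"
  unfolding foldr_conv_fold by (intro computable_fold computable_rev assms)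

lemma computable_append [comp_intros]:
  assumes "computable A f" "computable A g"
  shows "computable A (\<lambda>x. f x @ g x)"
proof -
  have "xs @ ys = foldr (\<lambda>y r. y # r) xs ys" for xs ys :: "'b list" by (induction xs) auto
  then show ?thesis by (simp only:) (intro comp_intros assms)
qed

lemma computable_map [comp_intros]:
  assumes "computable A (\<lambda>z. g (fst z) (snd z))" "computable A l"
  shows "computable A (\<lambda>x. map (g x) (l x))"
proof -
  have "map h xs = foldr (\<lambda>y r. h y # r) xs []" for h :: "'b \<Rightarrow> 'c" and xs by (induction xs) auto
  then show ?thesis by (simp only:) (intro comp_intros assms computable_compose2[OF assms(1)])
qed

lemma computable_filter [comp_intros]:
  assumes "decidable A (\<lambda>z. p (fst z) (snd z))" "computable A l"
  shows "computable A (\<lambda>x. filter (p x) (l x))"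
proof -
  have "filter h xs = foldr (\<lambda>y r. if h y then y # r else r) xs []" for h and xs :: "'b list"
    by (induction xs) auto
  then show ?thesis by (simp only:) (intro comp_intros assms decidable_compose2[OF assms(1)])
qed

lemma computable_concat [comp_intros]:
  assumes "computable A l" shows "computable A (\<lambda>x. concat (l x))"
  unfolding concat_conv_foldr by (intro comp_intros assms)

lemma computable_upt [comp_intros]:
  assumes "computable A f" shows "computable A (\<lambda>x. [0..<f x])"
proof -
  have "[0..<n] = rec_nat [] (\<lambda>k r. r @ [k]) n" for n by (induction n) auto
  then show ?thesis by (simp only:) (intro comp_intros assms)
qed

lemma computable_replicate [comp_intros]:
  assumes "computable A f" "computable A g" shows "computable A (\<lambda>x. replicate (f x) (g x))"
proof -
  have "replicate n a = rec_nat [] (\<lambda>_ r. a # r) n" for n and a :: 'b by (induction n) auto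
  then show ?thesis by (simp only:) (intro comp_intros assms computable_compose[OF assms(2)])
qed

lemma computable_sum_list [comp_intros]:
  assumes "computable A l" shows "computable A (\<lambda>x. sum_list (l x) :: nat)"
  unfolding sum_list.eq_foldr comp_def by (intro comp_intros assms)

lemma computable_sum_list_int [comp_intros]:
  assumes "computable A l" shows "computable A (\<lambda>x. sum_list (l x) :: int)"
  unfolding sum_list.eq_foldr comp_def by (intro comp_intros assms)

lemma computable_count_list [comp_intros]:
  assumes "computable A l" "computable A f" shows "computable A (\<lambda>x. count_list (l x) (f x))"
proof -
  have "count_list xs a = foldr (\<lambda>y r. if y = a then Suc r else r) xs 0" for xs and a :: 'b
    by (induction xs) auto
  then show ?thesis by (simp only:) (intro comp_intros assms computable_compose[OF assms(2)])
qed

lemma decidable_member [comp_intros]: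
  assumes "computable A f" "computable A l" shows "decidable A (\<lambda>x. f x \<in> set (l x))"
proof -
  have "a \<in> set xs \<longleftrightarrow> \<not> count_list xs a = 0" for xs and a :: 'b
    by (simp add: count_list_0_iff)
  then show ?thesis by (simp only:) (intro comp_intros assms)
qed

text \<open>A set of numbers is sorted by testing all numbers up to a bound for membership; the sum of a
  list bounds its entries.\<close>

lemma computable_sorted_list_of_set [comp_intros]:
  assumes "computable A l" shows "computable A (\<lambda>x. sorted_list_of_set (set (l x) :: nat set))"
proof -
  have "sorted_list_of_set (set xs) = filter (\<lambda>n. n \<in> set xs) [0..<Suc (sum_list xs)]" for xs :: "nat list"
  proof (rule sorted_distinct_set_unique)
    show "set (sorted_list_of_set (set xs)) = set (filter (\<lambda>n. n \<in> set xs) [0..<Suc (sum_list xs)])"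
      using member_le_sum_list[of _ xs] by (auto simp del: upt_Suc simp: less_Suc_eq_le)
  qed (simp_all add: sorted_wrt_filter del: upt_Suc)
  then show ?thesis by (simp only:) (intro comp_intros assms computable_compose[OF assms])
qed

section \<open>Programs without oracle\<close>

text \<open>Over the empty oracle, a query answers zero to a single argument and diverges on any other number
  of arguments. The composition with \<open>Succ\<close> reproduces that divergence.\<close>

fun unquery :: "prog \<Rightarrow> prog" where
  "unquery Query = Comp Zero [Succ]"
| "unquery (Comp f gs) = Comp (unquery f) (map unquery gs)"
| "unquery (PrimRec f g) = PrimRec (unquery f) (unquery g)"
| "unquery (Mu f) = Mu (unquery f)"
| "unquery P = P"

lemma run_unquery: "run A (unquery P) xs = run {} P xs"
proof (induction P arbitrary: xs)
  case (Comp f gs)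
  then show ?case by (auto simp: comp_def cong: map_cong)
qed (auto split: list.split)

text \<open>A polynomial is written as a sum of terms without collecting equal monomials. A monomial is the word
  of its variables, with repetition and in any order. So addition is \<open>@\<close>, multiplication of monomials
  is \<open>@\<close> too, and renaming of variables is \<open>map\<close>.\<close>

type_synonym terms = "(nat list \<times> int) list"

section \<open>Integer polynomials as lists of words\<close>

definition evaluate :: "(nat \<Rightarrow> rat) \<Rightarrow> terms \<Rightarrow> rat" where
  "evaluate x W = (\<Sum>t\<leftarrow>W. of_int (snd t) * (\<Prod>v\<leftarrow>fst t. x v))"

definition variables_below :: "nat \<Rightarrow> terms \<Rightarrow> bool" where
  "variables_below q W \<longleftrightarrow> (\<forall>t\<in>set W. set (fst t) \<subseteq> {..<q})"

definition times_terms :: "terms \<Rightarrow> terms \<Rightarrow> terms" where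
  "times_terms U V = concat (map (\<lambda>s. map (\<lambda>t. (fst s @ fst t, snd s * snd t)) V) U)"

definition square :: "terms \<Rightarrow> terms" where
  "square W = times_terms W W"

definition product :: "terms list \<Rightarrow> terms" where
  "product Ws = foldr times_terms Ws [([], 1)]"

definition shift :: "nat \<Rightarrow> terms \<Rightarrow> terms" where
  "shift k W = map (\<lambda>t. (map (\<lambda>v. k + v) (fst t), snd t)) W"

lemma evaluate_Nil [simp]: "evaluate x [] = 0"
  by (simp add: evaluate_def)

lemma evaluate_Cons [simp]: "evaluate x (t # W) = of_int (snd t) * (\<Prod>v\<leftarrow>fst t. x v) + evaluate x W"
  by (simp add: evaluate_def)

lemma evaluate_append [simp]: "evaluate x (U @ V) = evaluate x U + evaluate x V"
  by (simp add: evaluate_def)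

lemma evaluate_concat: "evaluate x (concat Ws) = (\<Sum>W\<leftarrow>Ws. evaluate x W)"
  by (induction Ws) simp_all

lemma evaluate_times [simp]: "evaluate x (times_terms U V) = evaluate x U * evaluate x V"
proof (induction U)
  case (Cons s U)
  have "evaluate x (map (\<lambda>t. (fst s @ fst t, snd s * snd t)) V) =
      of_int (snd s) * (\<Prod>v\<leftarrow>fst s. x v) * evaluate x V"
    by (induction V) (simp_all add: algebra_simps)
  with Cons show ?case by (simp add: times_terms_def algebra_simps)
qed (simp add: times_terms_def)

lemma evaluate_square [simp]: "evaluate x (square W) = (evaluate x W)\<^sup>2"
  by (simp add: square_def power2_eq_square)

lemma evaluate_product_eq_0_iff: "evaluate x (product Ws) = 0 \<longleftrightarrow> (\<exists>W\<in>set Ws. evaluate x W = 0)"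
  by (induction Ws) (simp_all add: product_def)

lemma evaluate_shift: "evaluate x (shift k W) = evaluate (\<lambda>v. x (k + v)) W"
  by (induction W) (simp_all add: shift_def comp_def)

lemma evaluate_cong:
  assumes "variables_below q W" "\<And>v. v < q \<Longrightarrow> x v = y v"
  shows "evaluate x W = evaluate y W"
proof -
  have "(\<Prod>v\<leftarrow>fst t. x v) = (\<Prod>v\<leftarrow>fst t. y v)" if "t \<in> set W" for t
    using assms that by (intro arg_cong[of _ _ prod_list] map_cong) (auto simp: variables_below_def)
  then show ?thesis
    unfolding evaluate_def by (intro arg_cong[of _ _ sum_list] map_cong) auto
qed

lemma variables_below_append [simp]:
  "variables_below q (U @ V) \<longleftrightarrow> variables_below q U \<and> variables_below q V"
  by (auto simp: variables_below_def)

lemma variables_below_concat [simp]: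
  "variables_below q (concat Ws) \<longleftrightarrow> (\<forall>W\<in>set Ws. variables_below q W)"
  by (auto simp: variables_below_def)

lemma variables_below_times [simp]:
  "variables_below q U \<Longrightarrow> variables_below q V \<Longrightarrow> variables_below q (times_terms U V)"
  by (fastforce simp: variables_below_def times_terms_def)

lemma variables_below_square [simp]: "variables_below q W \<Longrightarrow> variables_below q (square W)"
  by (simp add: square_def)

lemma variables_below_product [simp]:
  "(\<And>W. W \<in> set Ws \<Longrightarrow> variables_below q W) \<Longrightarrow> variables_below q (product Ws)"
  by (induction Ws) (simp_all add: product_def variables_below_def[of _ "[([], 1)]"])

lemma variables_below_shift:
  "variables_below p W \<Longrightarrow> k + p \<le> q \<Longrightarrow> variables_below q (shift k W)"
  by (force simp: variables_below_def shift_def)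

lemma variables_below_mono: "variables_below p W \<Longrightarrow> p \<le> q \<Longrightarrow> variables_below q W"
  by (force simp: variables_below_def)

section \<open>Having several solutions as a single equation\<close>

definition distance :: "nat \<Rightarrow> nat \<Rightarrow> nat \<Rightarrow> terms" where
  "distance p i j = concat (map (\<lambda>k. square [([p * i + k], 1), ([p * j + k], -1)]) [0..<p])"

definition separation :: "nat \<Rightarrow> nat \<Rightarrow> terms" where
  "separation p b = product (concat (map (\<lambda>j. map (\<lambda>i. distance p i j) [0..<j]) [0..<b]))"

text \<open>Block \<open>i\<close>, the variables \<open>p i, \<dots>, p i + p - 1\<close>, holds the \<open>i\<close>-th candidate solution; the
  additional variable \<open>p b\<close> holds the inverse of the product of all squared distances.\<close>

definition several_solutions :: "nat \<Rightarrow> nat \<Rightarrow> terms \<Rightarrow> terms" where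
  "several_solutions p b W =
     concat (map (\<lambda>i. square (shift (p * i) W)) [0..<b]) @
     square (([], -1) # times_terms [([p * b], 1)] (separation p b))"

lemma block_index_less:
  fixes p :: nat
  assumes "i < b" "k < p"
  shows "p * i + k < p * b"
proof -
  have "p * i + k < p * Suc i" using assms by simp
  also have "\<dots> \<le> p * b" using assms by (intro mult_le_mono2) simp
  finally show ?thesis .
qed

lemma variables_below_separation: "variables_below (p * b) (separation p b)"
proof -
  have "variables_below (p * b) (distance p i j)" if "i < j" "j < b" for i j
    unfolding distance_def using that
    by (auto intro!: variables_below_square block_index_less simp: variables_below_def[of _ "[_, _]"])
  then show ?thesis by (auto simp: separation_def intro!: variables_below_product)
qed

lemma variables_below_several_solutions:
  assumes "variables_below p W"
  shows "variables_below (p * b + 1) (several_solutions p b W)"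
proof -
  have "p * i + p \<le> p * b + 1" if "i < b" for i
  proof -
    have "p * Suc i \<le> p * b" using that by (intro mult_le_mono2) simp
    then show ?thesis by simp
  qed
  then have "\<forall>i<b. variables_below (p * b + 1) (shift (p * i) W)"
    using assms variables_below_shift by blast
  moreover have "variables_below (p * b + 1) (separation p b)"
    using variables_below_separation by (rule variables_below_mono) simp
  then have "variables_below (p * b + 1) (times_terms [([p * b], 1)] (separation p b))"
    by (intro variables_below_times) (simp_all add: variables_below_def)
  then have "variables_below (p * b + 1) (([], -1) # times_terms [([p * b], 1)] (separation p b))"
    by (simp add: variables_below_def)
  ultimately show ?thesis by (simp add: several_solutions_def)
qed

lemma evaluate_distance_eq_0_iff:
  "evaluate x (distance p i j) = 0 \<longleftrightarrow> (\<forall>k<p. x (p * i + k) = x (p * j + k))"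
proof -
  have "evaluate x (distance p i j) = (\<Sum>k\<leftarrow>[0..<p]. (x (p * i + k) - x (p * j + k))\<^sup>2)"
    by (simp add: distance_def evaluate_concat comp_def)
  also have "\<dots> = 0 \<longleftrightarrow> (\<forall>k<p. x (p * i + k) = x (p * j + k))"
    by (subst sum_list_nonneg_eq_0_iff) auto
  finally show ?thesis .
qed

lemma evaluate_separation_eq_0_iff:
  "evaluate x (separation p b) = 0 \<longleftrightarrow>
     (\<exists>i j. i < j \<and> j < b \<and> (\<forall>k<p. x (p * i + k) = x (p * j + k)))"
proof -
  have "evaluate x (separation p b) = 0 \<longleftrightarrow> (\<exists>j<b. \<exists>i<j. evaluate x (distance p i j) = 0)"
    by (simp add: separation_def evaluate_product_eq_0_iff) (auto simp: Bex_def)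
  then show ?thesis by (auto simp: evaluate_distance_eq_0_iff)
qed

lemma evaluate_several_solutions_eq_0_iff:
  "evaluate x (several_solutions p b W) = 0 \<longleftrightarrow>
     (\<forall>i<b. evaluate (\<lambda>v. x (p * i + v)) W = 0) \<and> x (p * b) * evaluate x (separation p b) = 1"
proof -
  have "evaluate x (several_solutions p b W) =
      (\<Sum>i\<leftarrow>[0..<b]. (evaluate (\<lambda>v. x (p * i + v)) W)\<^sup>2) + (x (p * b) * evaluate x (separation p b) - 1)\<^sup>2"
    by (simp add: several_solutions_def evaluate_concat evaluate_shift comp_def)
  moreover have "(\<Sum>i\<leftarrow>[0..<b]. (evaluate (\<lambda>v. x (p * i + v)) W)\<^sup>2) \<ge> 0"
    by (rule sum_list_nonneg) auto
  moreover have "(\<Sum>i\<leftarrow>[0..<b]. (evaluate (\<lambda>v. x (p * i + v)) W)\<^sup>2) = 0 \<longleftrightarrow>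
      (\<forall>i<b. evaluate (\<lambda>v. x (p * i + v)) W = 0)"
    by (subst sum_list_nonneg_eq_0_iff) auto
  ultimately show ?thesis
    by (simp add: add_nonneg_eq_0_iff)
qed

definition solutions :: "nat \<Rightarrow> terms \<Rightarrow> rat list set" where
  "solutions p W = {xs. length xs = p \<and> evaluate ((!) xs) W = 0}"

text \<open>The blocks of a solution are \<open>b\<close> distinct solutions; conversely, \<open>b\<close> distinct solutions in any order
  form the blocks, and the product of their squared distances has an inverse.\<close>

lemma solutions_several_solutions:
  assumes W: "variables_below p W"
  shows "solutions (p * b + 1) (several_solutions p b W) \<noteq> {} \<longleftrightarrow>
    (\<exists>S\<subseteq>solutions p W. finite S \<and> card S = b)"
proof
  assume "solutions (p * b + 1) (several_solutions p b W) \<noteq> {}"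
  then obtain xs where xs: "evaluate ((!) xs) (several_solutions p b W) = 0"
    by (auto simp: solutions_def)
  define block where "block i = map (\<lambda>k. xs ! (p * i + k)) [0..<p]" for i
  have sol: "block i \<in> solutions p W" if "i < b" for i
  proof -
    have "evaluate ((!) (block i)) W = evaluate (\<lambda>v. xs ! (p * i + v)) W"
      using W by (rule evaluate_cong) (simp add: block_def)
    then show ?thesis
      using xs that by (simp add: solutions_def evaluate_several_solutions_eq_0_iff) (simp add: block_def)
  qed
  have "evaluate ((!) xs) (separation p b) \<noteq> 0"
    using xs by (auto simp: evaluate_several_solutions_eq_0_iff)
  then have neq: "block i \<noteq> block j" if "i < j" "j < b" for i j
    using that by (auto simp: evaluate_separation_eq_0_iff block_def list_eq_iff_nth_eq)
  have "inj_on block {..<b}"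
    by (rule linorder_inj_onI) (use neq in auto)
  then have "card (block ` {..<b}) = b" by (simp add: card_image)
  with sol show "\<exists>S\<subseteq>solutions p W. finite S \<and> card S = b"
    by (intro exI[of _ "block ` {..<b}"]) auto
next
  assume "\<exists>S\<subseteq>solutions p W. finite S \<and> card S = b"
  then obtain S where S: "S \<subseteq> solutions p W" "finite S" "card S = b" by blast
  then obtain ss where ss: "set ss = S" "distinct ss" "length ss = b"
    using finite_distinct_list distinct_card by metis
  have ss_sol: "ss ! i \<in> solutions p W" if "i < b" for i
    using that S ss by auto
  \<comment> \<open>\<open>y\<close> is the concatenation of the \<open>b\<close> points, given by coordinates.\<close>
  define y where "y v = ss ! (v div p) ! (v mod p)" for v
  have y: "y (p * i + k) = ss ! i ! k" if "k < p" for i k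
    using that by (simp add: y_def)
  have sep: "evaluate y (separation p b) \<noteq> 0"
  proof
    assume "evaluate y (separation p b) = 0"
    then obtain i j where ij: "i < j" "j < b" "\<forall>k<p. y (p * i + k) = y (p * j + k)"
      by (auto simp: evaluate_separation_eq_0_iff)
    have "ss ! i = ss ! j"
      using ij ss_sol[of i] ss_sol[of j] by (intro nth_equalityI) (auto simp: solutions_def y)
    with ij ss show False by (simp add: nth_eq_iff_index_eq)
  qed
  define xs where "xs = map y [0..<p * b] @ [1 / evaluate y (separation p b)]"
  have xs_y: "xs ! v = y v" if "v < p * b" for v
    using that by (simp add: xs_def nth_append)
  have "evaluate ((!) xs) (separation p b) = evaluate y (separation p b)"
    using variables_below_separation xs_y by (rule evaluate_cong)
  moreover have "xs ! (p * b) = 1 / evaluate y (separation p b)"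
    by (simp add: xs_def nth_append)
  moreover have "evaluate (\<lambda>v. xs ! (p * i + v)) W = 0" if "i < b" for i
  proof -
    have "evaluate (\<lambda>v. xs ! (p * i + v)) W = evaluate ((!) (ss ! i)) W"
      using W by (rule evaluate_cong) (simp add: xs_y block_index_less that y)
    then show ?thesis using ss_sol[OF that] by (simp add: solutions_def)
  qed
  ultimately have "evaluate ((!) xs) (several_solutions p b W) = 0"
    using sep by (simp add: evaluate_several_solutions_eq_0_iff)
  then show "solutions (p * b + 1) (several_solutions p b W) \<noteq> {}"
    by (auto simp: solutions_def xs_def intro!: exI[of _ xs])
qed

section \<open>Codes of equations\<close>

definition monomial :: "nat \<Rightarrow> nat list \<Rightarrow> nat \<Rightarrow>\<^sub>0 nat" where
  "monomial q w = (\<Sum>i<q. Poly_Mapping.single i (count_list w i))"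

definition polynomial :: "nat \<Rightarrow> terms \<Rightarrow> int_mpoly" where
  "polynomial q W = (\<Sum>t\<leftarrow>W. Poly_Mapping.single (monomial q (fst t)) (snd t))"

definition exponents :: "nat \<Rightarrow> nat list \<Rightarrow> nat list" where
  "exponents q w = map (\<lambda>i. count_list w i) [0..<q]"

definition coefficient :: "nat \<Rightarrow> terms \<Rightarrow> nat list \<Rightarrow> int" where
  "coefficient q W w = sum_list (map snd (filter (\<lambda>t. exponents q (fst t) = exponents q w) W))"

text \<open>This computes the list in \<open>equation_code\<close> without going through finitely supported functions. A
  monomial may occur in several terms of \<open>W\<close>; each occurrence contributes the same code, and the set
  identifies them.\<close>

definition normal_form :: "nat \<Rightarrow> terms \<Rightarrow> nat list" where
  "normal_form q W = sorted_list_of_set (set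
     (map (\<lambda>t. enc (exponents q (fst t), coefficient q W (fst t)))
       (filter (\<lambda>t. coefficient q W (fst t) \<noteq> 0) W)))"

lemma lookup_monomial:
  "Poly_Mapping.lookup (monomial q w) i = (if i < q then count_list w i else 0)"
  by (simp add: monomial_def lookup_sum lookup_single when_def)

text \<open>Both sides look only at the first \<open>q\<close> variables and ignore the others. Hence \<open>normal_form\<close> yields the code of an equation for every list of terms.\<close>

lemma monomial_eq_iff: "monomial q v = monomial q w \<longleftrightarrow> exponents q v = exponents q w"
  by (auto simp: poly_mapping_eq_iff fun_eq_iff lookup_monomial exponents_def)

lemma keys_monomial: "Poly_Mapping.keys (monomial q w) \<subseteq> {..<q}"
  by (auto simp: in_keys_iff lookup_monomial split: if_splits)

lemma exponents_conv_lookup: "map (Poly_Mapping.lookup (monomial q w)) [0..<q] = exponents q w"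
  by (simp add: exponents_def lookup_monomial)

lemma lookup_polynomial:
  "Poly_Mapping.lookup (polynomial q W) m = (\<Sum>t\<leftarrow>W. snd t when monomial q (fst t) = m)"
  by (induction W) (simp_all add: polynomial_def lookup_add lookup_single)

lemma lookup_polynomial_monomial:
  "Poly_Mapping.lookup (polynomial q W) (monomial q w) = coefficient q W w"
proof -
  have "(\<Sum>t\<leftarrow>V. snd t when monomial q (fst t) = monomial q w) =
      sum_list (map snd (filter (\<lambda>t. exponents q (fst t) = exponents q w) V))" for V :: terms
    by (induction V) (simp_all add: monomial_eq_iff)
  then show ?thesis by (simp add: lookup_polynomial coefficient_def)
qed

lemma keys_polynomial:
  "Poly_Mapping.keys (polynomial q W) =
     (\<lambda>t. monomial q (fst t)) ` set (filter (\<lambda>t. coefficient q W (fst t) \<noteq> 0) W)"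
proof (intro equalityI subsetI)
  fix m assume m: "m \<in> Poly_Mapping.keys (polynomial q W)"
  have "\<exists>t\<in>set W. monomial q (fst t) = m"
  proof (rule ccontr)
    assume "\<not> ?thesis"
    then have "Poly_Mapping.lookup (polynomial q W) m = (\<Sum>t\<leftarrow>W. 0)"
      unfolding lookup_polynomial by (intro arg_cong[of _ _ sum_list] map_cong) (auto simp: when_def)
    with m show False by (simp add: in_keys_iff)
  qed
  with m show "m \<in> (\<lambda>t. monomial q (fst t)) ` set (filter (\<lambda>t. coefficient q W (fst t) \<noteq> 0) W)"
    by (auto simp: in_keys_iff lookup_polynomial_monomial)
qed (auto simp: in_keys_iff lookup_polynomial_monomial)

lemma polynomial_diophantine: "q \<ge> 1 \<Longrightarrow> (q, polynomial q W) \<in> diophantine_equations"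
  using keys_monomial by (auto simp: diophantine_equations_def keys_polynomial)

lemma equation_code_polynomial: "equation_code (q, polynomial q W) = enc (q, normal_form q W)"
proof -
  have "term_code q (polynomial q W) (monomial q w) = enc (exponents q w, coefficient q W w)" for w
    by (simp add: term_code_def exponents_conv_lookup lookup_polynomial_monomial enc_prod_def
        enc_nat_list enc_int_def)
  then have "term_code q (polynomial q W) ` Poly_Mapping.keys (polynomial q W) =
      set (map (\<lambda>t. enc (exponents q (fst t), coefficient q W (fst t)))
        (filter (\<lambda>t. coefficient q W (fst t) \<noteq> 0) W))"
    by (auto simp: keys_polynomial image_image)
  then show ?thesis
    by (simp add: equation_code_def normal_form_def enc_prod_def enc_nat_list)
qed

text \<open>Summing over any superset of the support makes evaluation additive: cancellation may remove
  monomials from the support of a sum.\<close>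

lemma mpoly_eval_superset:
  assumes "finite S" "Poly_Mapping.keys D \<subseteq> S"
  shows "mpoly_eval D x = (\<Sum>m\<in>S. of_int (Poly_Mapping.lookup D m) *
    (\<Prod>i\<in>Poly_Mapping.keys m. x i ^ Poly_Mapping.lookup m i))"
  unfolding mpoly_eval_def using assms by (intro sum.mono_neutral_left) (auto simp: in_keys_iff)

lemma mpoly_eval_add: "mpoly_eval (D + G) x = mpoly_eval D x + mpoly_eval G x"
proof -
  let ?S = "Poly_Mapping.keys D \<union> Poly_Mapping.keys G"
  have "finite ?S" by simp
  then show ?thesis
    using keys_add[of D G]
    by (simp add: mpoly_eval_superset[of ?S] lookup_add algebra_simps sum.distrib)
qed

lemma mpoly_eval_single:
  "mpoly_eval (Poly_Mapping.single m c) x =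
     of_int c * (\<Prod>i\<in>Poly_Mapping.keys m. x i ^ Poly_Mapping.lookup m i)"
  by (subst mpoly_eval_superset[of "{m}"]) auto

lemma prod_monomial:
  assumes "set w \<subseteq> {..<q}"
  shows "(\<Prod>i\<in>Poly_Mapping.keys (monomial q w). x i ^ Poly_Mapping.lookup (monomial q w) i) =
    (\<Prod>v\<leftarrow>w. x v :: rat)"
proof -
  have "(\<Prod>i\<in>Poly_Mapping.keys (monomial q w). x i ^ Poly_Mapping.lookup (monomial q w) i) =
      (\<Prod>i<q. x i ^ Poly_Mapping.lookup (monomial q w) i)"
    using keys_monomial by (intro prod.mono_neutral_left) (auto simp: in_keys_iff)
  also have "\<dots> = (\<Prod>i<q. x i ^ count_list w i)"
    by (simp add: lookup_monomial)
  also have "\<dots> = (\<Prod>v\<leftarrow>w. x v)"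
    using assms
  proof (induction w)
    case (Cons v w)
    have "(\<Prod>i<q. x i ^ count_list (v # w) i) = (\<Prod>i<q. (if i = v then x i else 1) * x i ^ count_list w i)"
      by (rule prod.cong) auto
    then show ?case using Cons by (simp add: prod.distrib)
  qed simp
  finally show ?thesis .
qed

lemma mpoly_eval_polynomial:
  assumes "variables_below q W"
  shows "mpoly_eval (polynomial q W) x = evaluate x W"
  using assms
proof (induction W)
  case (Cons t W)
  then have "variables_below q W" "set (fst t) \<subseteq> {..<q}" by (auto simp: variables_below_def)
  then show ?case
    using Cons.IH by (simp add: polynomial_def mpoly_eval_add mpoly_eval_single prod_monomial)
qed (simp add: polynomial_def mpoly_eval_def)

lemma rational_solutions_polynomial:
  "variables_below q W \<Longrightarrow> rational_solutions (q, polynomial q W) = solutions q W"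
  by (simp add: rational_solutions_def solutions_def mpoly_eval_polynomial)

text \<open>The sorted word of a monomial with the given list of exponents. It leads from codes, where monomials
  are lists of exponents, to words.\<close>

fun word :: "nat list \<Rightarrow> nat list" where
  "word [] = []"
| "word (e # es) = replicate e 0 @ map Suc (word es)"

definition words :: "terms \<Rightarrow> terms" where
  "words ts = map (\<lambda>t. (word (fst t), snd t)) ts"

text \<open>Comparing the normal form with the input tests at once that all exponent lists have length \<open>p\<close>, that
  no coefficient is zero, that no monomial is repeated, and that the terms are sorted. The
  comparison is made between codes because the normal form lists the codes of the terms.\<close>

definition is_equation :: "nat \<times> terms \<Rightarrow> bool" where
  "is_equation E \<longleftrightarrow> 0 < fst E \<and> enc (normal_form (fst E) (words (snd E))) = enc (snd E)"

definition equation :: "nat \<times> terms \<Rightarrow> nat \<times> int_mpoly" where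
  "equation E = (fst E, polynomial (fst E) (words (snd E)))"

lemma count_word: "count_list (word es) i = (if i < length es then es ! i else 0)"
proof (induction es arbitrary: i)
  case (Cons e es)
  have "count_list (replicate e (0::nat)) i = (if i = 0 then e else 0)"
    by (induction e) auto
  moreover have "count_list (map Suc w) i = (case i of 0 \<Rightarrow> 0 | Suc j \<Rightarrow> count_list w j)" for w
    by (induction w) (auto split: nat.split)
  ultimately show ?case using Cons by (simp split: nat.split)
qed simp

lemma equation_code_equation: "is_equation E \<Longrightarrow> equation_code (equation E) = enc E"
  by (simp add: is_equation_def equation_def equation_code_polynomial enc_prod_def)

lemma equation_diophantine: "is_equation E \<Longrightarrow> equation E \<in> diophantine_equations"
  by (simp add: is_equation_def equation_def polynomial_diophantine)

lemma variables_below_words: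
  assumes "is_equation E"
  shows "variables_below (fst E) (words (snd E))"
proof -
  have "enc (normal_form (fst E) (words (snd E))) = enc (map enc (snd E) :: nat list)"
    using assms by (simp add: is_equation_def enc_nat_list enc_list_def[of "snd E"])
  then have nf: "normal_form (fst E) (words (snd E)) = map enc (snd E)" by simp
  have "set (word (fst t)) \<subseteq> {..<fst E}" if "t \<in> set (snd E)" for t
  proof -
    have "enc t \<in> set (normal_form (fst E) (words (snd E)))" using that nf by simp
    then have "length (fst t) = fst E"
      by (auto simp: normal_form_def exponents_def)
    then show ?thesis
      using count_word[of "fst t"] by (metis count_list_0_iff lessThan_iff subsetI)
  qed
  then show ?thesis by (auto simp: variables_below_def words_def)
qed

text \<open>Decoding the list in the code of \<open>(p, D)\<close> gives each monomial of \<open>D\<close> with its coefficient exactly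
  once, so the sum of these terms is \<open>D\<close> again.\<close>

lemma diophantine_equation_cases:
  assumes F: "F \<in> diophantine_equations"
  obtains E where "is_equation E" "equation E = F"
proof -
  obtain p D where [simp]: "F = (p, D)" by (cases F)
  have p: "p \<ge> 1" and keys: "m \<in> Poly_Mapping.keys D \<Longrightarrow> Poly_Mapping.keys m \<subseteq> {..<p}" for m
    using F by (auto simp: diophantine_equations_def)
  let ?c = "term_code p D ` Poly_Mapping.keys D"
  define ts :: terms where "ts = map dec (sorted_list_of_set ?c)"
  have code: "equation_code F = enc (p, ts)"
  proof -
    have "enc ts = list_encode (sorted_list_of_set ?c)"
      by (simp add: ts_def enc_list_def comp_def)
    then show ?thesis by (simp add: equation_code_def enc_prod_def)
  qed
  define entry where "entry m = (map (Poly_Mapping.lookup m) [0..<p], Poly_Mapping.lookup D m)" for m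
  have dec_entry: "dec (term_code p D m) = entry m" for m
    by (rule dec_eqI) (simp add: entry_def term_code_def enc_prod_def enc_nat_list enc_int_def)
  have "inj_on entry (Poly_Mapping.keys D)"
    using keys by (intro inj_onI) (auto simp: entry_def intro!: exponents_inject simp del: map_eq_conv)
  have "distinct ts"
    unfolding ts_def by (simp add: distinct_map inj_onI) (metis enc_dec inj_onI)
  moreover have "set ts = entry ` Poly_Mapping.keys D"
    by (simp add: ts_def image_image dec_entry)
  moreover have "monomial p (word (map (Poly_Mapping.lookup m) [0..<p])) = m"
    if "m \<in> Poly_Mapping.keys D" for m
  proof (rule poly_mapping_eqI)
    show "Poly_Mapping.lookup (monomial p (word (map (Poly_Mapping.lookup m) [0..<p]))) i =
        Poly_Mapping.lookup m i" for i
      using keys[OF that] by (auto simp: lookup_monomial count_word in_keys_iff subset_iff)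
  qed
  ultimately have "polynomial p (words ts) = (\<Sum>m\<in>Poly_Mapping.keys D. Poly_Mapping.single m (Poly_Mapping.lookup D m))"
    using \<open>inj_on entry _\<close>
    by (simp add: polynomial_def words_def comp_def sum_list_distinct_conv_sum_set sum.reindex)
      (simp add: entry_def)
  also have "\<dots> = D"
    by (rule poly_mapping_eqI) (auto simp: lookup_sum lookup_single when_def in_keys_iff)
  finally have D: "equation (p, ts) = F" by (simp add: equation_def)
  with code p have "is_equation (p, ts)"
    by (auto simp: is_equation_def equation_def equation_code_polynomial enc_prod_def)
  with D that show ?thesis by blast
qed

section \<open>Computability of the constructions\<close>

lemma computable_word [comp_intros]:
  assumes "computable A f" shows "computable A (\<lambda>x. word (f x))"
proof -
  have "word es = foldr (\<lambda>e w. replicate e 0 @ map Suc w) es []" for es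
    by (induction es) simp_all
  then show ?thesis by (simp only:) (intro comp_intros assms)
qed

lemma computable_words [comp_intros]:
  "computable A f \<Longrightarrow> computable A (\<lambda>x. words (f x))"
  unfolding words_def by (intro comp_intros)

lemma computable_times_terms [comp_intros]:
  assumes "computable A f" "computable A g"
  shows "computable A (\<lambda>x. times_terms (f x) (g x))"
  unfolding times_terms_def by (intro comp_intros assms computable_compose[OF assms(2)])

lemma computable_square [comp_intros]:
  "computable A f \<Longrightarrow> computable A (\<lambda>x. square (f x))"
  unfolding square_def by (intro comp_intros)

lemma computable_product [comp_intros]:
  "computable A f \<Longrightarrow> computable A (\<lambda>x. product (f x))"
  unfolding product_def by (intro comp_intros)

lemma computable_shift [comp_intros]:
  assumes "computable A f" "computable A g"
  shows "computable A (\<lambda>x. shift (f x) (g x))"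
  unfolding shift_def by (intro comp_intros assms computable_compose[OF assms(1)])

lemma computable_distance [comp_intros]:
  assumes "computable A f" "computable A g" "computable A h"
  shows "computable A (\<lambda>x. distance (f x) (g x) (h x))"
  unfolding distance_def
  by (intro comp_intros assms computable_compose[OF assms(1)] computable_compose[OF assms(2)]
      computable_compose[OF assms(3)])

lemma computable_separation [comp_intros]:
  assumes "computable A f" "computable A g"
  shows "computable A (\<lambda>x. separation (f x) (g x))"
  unfolding separation_def by (intro comp_intros assms computable_compose[OF assms(1)])

lemma computable_several_solutions [comp_intros]:
  assumes "computable A f" "computable A g" "computable A h"
  shows "computable A (\<lambda>x. several_solutions (f x) (g x) (h x))"
  unfolding several_solutions_def
  by (intro comp_intros assms computable_compose[OF assms(1)] computable_compose[OF assms(3)])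

lemma computable_exponents [comp_intros]:
  assumes "computable A f" "computable A g"
  shows "computable A (\<lambda>x. exponents (f x) (g x))"
  unfolding exponents_def by (intro comp_intros assms computable_compose[OF assms(2)])

lemma computable_coefficient [comp_intros]:
  assumes "computable A f" "computable A g" "computable A h"
  shows "computable A (\<lambda>x. coefficient (f x) (g x) (h x))"
  unfolding coefficient_def
  by (intro comp_intros assms computable_compose[OF assms(1)] computable_compose[OF assms(3)])

lemma computable_normal_form [comp_intros]:
  assumes "computable A f" "computable A g"
  shows "computable A (\<lambda>x. normal_form (f x) (g x))"
  unfolding normal_form_def
  by (intro comp_intros assms computable_compose[OF assms(1)] computable_compose[OF assms(2)])

lemma decidable_is_equation [comp_intros]:
  "computable A f \<Longrightarrow> decidable A (\<lambda>x. is_equation (f x))"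
  unfolding is_equation_def by (intro comp_intros)

theorem theorem8:
  assumes "\<exists>b. computable_on_equations b \<and>
    (\<forall>E\<in>diophantine_equations. b E \<ge> 2 \<and>
       (finite (rational_solutions E) \<longrightarrow> b E > card (rational_solutions E)))"
  shows "turing_reducible
    (equation_code ` {E \<in> diophantine_equations. finite (rational_solutions E)})
    (equation_code ` {E \<in> diophantine_equations. rational_solutions E \<noteq> {}})"
    (is "turing_reducible ?F ?S")
proof -
  obtain b where b_comp: "computable_on_equations b"
    and b_bound: "\<And>E. E \<in> diophantine_equations \<Longrightarrow> finite (rational_solutions E) \<Longrightarrow>
      card (rational_solutions E) < b E"
    using assms by blast
  \<comment> \<open>The default value \<open>(1, [])\<close> is the equation \<open>0 = 0\<close> in one variable.\<close>
  define valid where "valid E = (if is_equation E then E else (1, []))" for E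
  have valid: "is_equation (valid E)" for E
    by (simp add: valid_def is_equation_def words_def normal_form_def)
  have b: "computable ?S (\<lambda>E. b (equation (valid E)))"
  proof -
    obtain P where P: "\<And>F. F \<in> diophantine_equations \<Longrightarrow> run {} P [equation_code F] = Some (b F)"
      using b_comp unfolding computable_on_equations_def by blast
    have "computable ?S valid"
      unfolding valid_def by (intro comp_intros)
    then obtain Q where Q: "\<And>E. run ?S Q [enc E] = Some (enc (valid E))"
      unfolding computable_def by blast
    have "run ?S (Comp (unquery P) [Q]) [enc E] = Some (b (equation (valid E)))" for E
      using P[OF equation_diophantine[OF valid]]
      by (simp add: Q run_unquery equation_code_equation valid)
    then show ?thesis unfolding computable_def enc_nat_def by blast
  qed
  define query where "query E = (let c = b (equation (valid E)) in
    enc (fst E * c + 1, normal_form (fst E * c + 1) (several_solutions (fst E) c (words (snd E)))))" for E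
  have query: "query E \<in> ?S \<longleftrightarrow> infinite (rational_solutions (equation E))" if E: "is_equation E" for E
  proof -
    let ?p = "fst E" and ?W = "words (snd E)" and ?c = "b (equation E)"
    let ?q = "?p * ?c + 1"
    let ?V = "several_solutions ?p ?c ?W"
    have W: "variables_below ?p ?W" by (rule variables_below_words[OF E])
    have sol: "rational_solutions (equation E) = solutions ?p ?W"
      unfolding equation_def using W by (rule rational_solutions_polynomial)
    have V: "(?q, polynomial ?q ?V) \<in> diophantine_equations"
      by (rule polynomial_diophantine) simp
    have "query E = equation_code (?q, polynomial ?q ?V)"
      using E by (simp add: query_def valid_def equation_code_polynomial Let_def)
    then have "query E \<in> ?S \<longleftrightarrow> rational_solutions (?q, polynomial ?q ?V) \<noteq> {}"
      using V inj_on_equation_code by (auto simp: inj_on_image_mem_iff[of _ diophantine_equations] inj_on_def)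
    also have "\<dots> \<longleftrightarrow> solutions ?q ?V \<noteq> {}"
      by (simp only: rational_solutions_polynomial[OF variables_below_several_solutions[OF W]])
    also have "\<dots> \<longleftrightarrow> (\<exists>S\<subseteq>solutions ?p ?W. finite S \<and> card S = ?c)"
      using W by (rule solutions_several_solutions)
    also have "\<dots> \<longleftrightarrow> infinite (solutions ?p ?W)"
    proof
      assume "\<exists>S\<subseteq>solutions ?p ?W. finite S \<and> card S = ?c"
      then show "infinite (solutions ?p ?W)"
        using b_bound[OF equation_diophantine[OF E]] sol by (metis card_mono leD)
    next
      assume "infinite (solutions ?p ?W)"
      then show "\<exists>S\<subseteq>solutions ?p ?W. finite S \<and> card S = ?c"
        using infinite_arbitrarily_large by blast
    qed
    finally show ?thesis using sol by simp
  qed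
  have "n \<in> ?F \<longleftrightarrow> is_equation (dec n) \<and> query (dec n) \<notin> ?S" for n
  proof
    assume "n \<in> ?F"
    then obtain F where F: "F \<in> diophantine_equations" "finite (rational_solutions F)" "n = equation_code F"
      by blast
    obtain E where E: "is_equation E" "equation E = F" using diophantine_equation_cases[OF F(1)] .
    have "dec n = E" using E F by (simp add: equation_code_equation dec_eqI flip: E(2))
    with E F show "is_equation (dec n) \<and> query (dec n) \<notin> ?S" by (simp only: query) simp
  next
    assume *: "is_equation (dec n) \<and> query (dec n) \<notin> ?S"
    then have "finite (rational_solutions (equation (dec n)))" using query by blast
    moreover have "n = equation_code (equation (dec n))" using * by (simp add: equation_code_equation)
    ultimately show "n \<in> ?F" using * equation_diophantine by blast
  qed
  moreover have "decidable ?S (\<lambda>n. is_equation (dec n) \<and> query (dec n) \<notin> ?S)"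
    unfolding query_def Let_def by (intro comp_intros computable_compose[OF b])
  ultimately show ?thesis unfolding turing_reducible_iff by presburger
qed

end
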